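(* The set $A[0,1]$ of all attractors of iterated function systems acting on $[0,1]$ is not $\sigma$-strongly porous in $K[0,1]$.
   Context: $K[0,1]$ denotes the space of all nonempty compact subsets of $[0,1]$ (with the usual metric $d(x,y)=|x-y|$), equipped with the Hausdorff metric $d_H(A,B)=\min\{r\ge 0: A\subseteq \widetilde{B}_r \text{ and } B\subseteq\widetilde{A}_r\}$, where $\widetilde{C}_r=\bigcup_{c\in C}\{x\in[0,1]: d(x,c)\le r\}$. A contraction on $[0,1]$ is a function $f:[0,1]\to[0,1]$ for which there is $L\in[0,1)$ with $|f(x)-f(y)|\le L|x-y|$ for all $x,y\in[0,1]$. An iterated function system (IFS) acting on $[0,1]$ is a finite nonempty collection $\{s_1,\dots,s_k\}$ of contractions on $[0,1]$. Its attractor is the unique $A\in K[0,1]$ satisfying $A=\bigcup_{i=1}^k s_i(A)$. $A[0,1]\subseteq K[0,1]$ is the set of all attractors of IFSs acting on $[0,1]$. Let $(X,\rho)$ be a metric space and write $B(z,r)$ for the open ball of radius $r$ centered at $z$. A set $A\subseteq X$ is strongly porous (in $X$) if for each $x\in X$ there are sequences $(x_n)\subseteq X$ and $(r_n)\subseteq(0,+\infty)$ such that $\lim_n x_n=x$, $\rho(x,x_n)>0$ for all $n$, $\lim_n \frac{r_n}{\rho(x,x_n)}=1$, and $B(x_n,r_n)\cap A=\emptyset$ for all $n$. A set is $\sigma$-strongly porous (in $X$) if it is a countable union of strongly porous sets. Here $X=K[0,1]$ and $\rho=d_H$. *)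

theory Defs
  imports "HOL-Analysis.Analysis"
begin

section \<open>The hyperspace \<open>K[0,1]\<close> with the Hausdorff metric\<close>

definition K01 :: "real set set" where
  "K01 = {A. A \<noteq> {} \<and> compact A \<and> A \<subseteq> {0..1}}"

definition nbhd01 :: "real set \<Rightarrow> real \<Rightarrow> real set" where
  "nbhd01 C r = (\<Union>c\<in>C. {x \<in> {0..1}. dist x c \<le> r})"

text \<open>
  For members of \<open>K01\<close> the minimum is attained (lemma \<open>hausdorff_dist01_minimum\<close>). The value \<open>0\<close>
  elsewhere serves only the locale \<open>Metric_space\<close>, which wants a nonnegative function on the whole type.
\<close>

definition hausdorff_dist01 :: "real set \<Rightarrow> real set \<Rightarrow> real" where
  "hausdorff_dist01 A B =
     (if A \<in> K01 \<and> B \<in> K01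
      then LEAST r. 0 \<le> r \<and> A \<subseteq> nbhd01 B r \<and> B \<subseteq> nbhd01 A r
      else 0)"

definition K01_metric :: "real set metric" where
  "K01_metric = metric (K01, hausdorff_dist01)"

lemma subset_nbhd01_iff:
  assumes "A \<in> K01" "B \<in> K01"
  shows "A \<subseteq> nbhd01 B r \<longleftrightarrow> (\<forall>a\<in>A. infdist a B \<le> r)"
proof
  assume "A \<subseteq> nbhd01 B r"
  then show "\<forall>a\<in>A. infdist a B \<le> r"
    by (fastforce simp: nbhd01_def intro: infdist_le2)
next
  assume *: "\<forall>a\<in>A. infdist a B \<le> r"
  have B: "closed B" "B \<noteq> {}"
    using assms by (auto simp: K01_def compact_imp_closed)
  show "A \<subseteq> nbhd01 B r"
  proof
    fix a assume a: "a \<in> A"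
    obtain b where "b \<in> B" "infdist a B = dist a b"
      using infdist_attains_inf[OF B] by metis
    with * a have "dist a b \<le> r" by auto
    moreover have "a \<in> {0..1}" using a assms by (auto simp: K01_def)
    ultimately show "a \<in> nbhd01 B r" using \<open>b \<in> B\<close> by (auto simp: nbhd01_def)
  qed
qed

lemma hausdorff_dist01_minimum:
  assumes A: "A \<in> K01" and B: "B \<in> K01"
  shows "0 \<le> hausdorff_dist01 A B"
    and "A \<subseteq> nbhd01 B (hausdorff_dist01 A B)"
    and "B \<subseteq> nbhd01 A (hausdorff_dist01 A B)"
    and "\<And>r. \<lbrakk>0 \<le> r; A \<subseteq> nbhd01 B r; B \<subseteq> nbhd01 A r\<rbrakk> \<Longrightarrow> hausdorff_dist01 A B \<le> r"
proof -
  define R where "R = {r. 0 \<le> r \<and> A \<subseteq> nbhd01 B r \<and> B \<subseteq> nbhd01 A r}"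
  have R: "R = {0..} \<inter> (\<Inter>a\<in>A. {infdist a B..}) \<inter> (\<Inter>b\<in>B. {infdist b A..})"
    unfolding R_def subset_nbhd01_iff[OF A B] subset_nbhd01_iff[OF B A] by auto
  have "closed R" unfolding R by (intro closed_Int closed_INT ballI closed_atLeast)
  moreover have "bdd_below R" unfolding R_def by (auto intro: bdd_belowI[where m=0])
  moreover have "1 \<in> R"
  proof -
    have "X \<subseteq> nbhd01 Y 1" if XY: "X \<in> K01" "Y \<in> K01" for X Y
    proof
      fix x assume x: "x \<in> X"
      obtain y where y: "y \<in> Y" using XY(2) by (auto simp: K01_def)
      have "x \<in> {0..1}" "y \<in> {0..1}" using x y XY by (auto simp: K01_def)
      then show "x \<in> nbhd01 Y 1" using y unfolding nbhd01_def by (intro UN_I[of y]) (auto simp: dist_real_def)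
    qed
    then show ?thesis using A B by (auto simp: R_def)
  qed
  ultimately have "Inf R \<in> R" using closed_contains_Inf by blast
  moreover have low: "Inf R \<le> r" if "r \<in> R" for r
    using that \<open>bdd_below R\<close> by (rule cInf_lower)
  ultimately have "hausdorff_dist01 A B = Inf R"
    unfolding hausdorff_dist01_def using A B by (auto simp: R_def intro!: Least_equality)
  then show "0 \<le> hausdorff_dist01 A B" "A \<subseteq> nbhd01 B (hausdorff_dist01 A B)"
    "B \<subseteq> nbhd01 A (hausdorff_dist01 A B)"
    "\<And>r. \<lbrakk>0 \<le> r; A \<subseteq> nbhd01 B r; B \<subseteq> nbhd01 A r\<rbrakk> \<Longrightarrow> hausdorff_dist01 A B \<le> r"
    using \<open>Inf R \<in> R\<close> low by (auto simp: R_def)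
qed

lemma nbhd01_trans:
  assumes "A \<subseteq> nbhd01 B r" "B \<subseteq> nbhd01 C s"
  shows "A \<subseteq> nbhd01 C (r + s)"
proof
  fix a assume "a \<in> A"
  then obtain b where b: "b \<in> B" "dist a b \<le> r" "a \<in> {0..1}"
    using assms(1) by (fastforce simp: nbhd01_def)
  then obtain c where c: "c \<in> C" "dist b c \<le> s"
    using assms(2) by (fastforce simp: nbhd01_def)
  have "dist a c \<le> r + s" using b c dist_triangle[of a c b] by linarith
  then show "a \<in> nbhd01 C (r + s)" using b c by (auto simp: nbhd01_def)
qed

lemma Metric_space_K01: "Metric_space K01 hausdorff_dist01"
proof
  show "0 \<le> hausdorff_dist01 A B" for A B
  proof (cases "A \<in> K01 \<and> B \<in> K01")
    case True
    then show ?thesis by (simp add: hausdorff_dist01_minimum(1))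
  next
    case False
    then show ?thesis by (auto simp: hausdorff_dist01_def)
  qed
  show "hausdorff_dist01 A B = hausdorff_dist01 B A" for A B
    unfolding hausdorff_dist01_def by (auto intro!: arg_cong[of _ _ Least])
  show "hausdorff_dist01 A B = 0 \<longleftrightarrow> A = B" if A: "A \<in> K01" and B: "B \<in> K01" for A B
  proof
    have eq: "X \<subseteq> nbhd01 Y 0 \<longleftrightarrow> X \<subseteq> Y" if "X \<in> K01" "Y \<in> K01" for X Y
      using that by (force simp: nbhd01_def K01_def)
    show "A = B" if "hausdorff_dist01 A B = 0"
      using hausdorff_dist01_minimum(2,3)[OF A B] that eq A B by auto
    show "hausdorff_dist01 A B = 0" if "A = B"
    proof -
      have "hausdorff_dist01 A B \<le> 0"
        by (rule hausdorff_dist01_minimum(4)[OF A B]) (use eq A B that in auto)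
      then show ?thesis using hausdorff_dist01_minimum(1)[OF A B] by simp
    qed
  qed
  show "hausdorff_dist01 A C \<le> hausdorff_dist01 A B + hausdorff_dist01 B C"
    if A: "A \<in> K01" and B: "B \<in> K01" and C: "C \<in> K01" for A B C
  proof -
    note m = hausdorff_dist01_minimum
    show ?thesis
    proof (rule m(4)[OF A C])
      show "0 \<le> hausdorff_dist01 A B + hausdorff_dist01 B C"
        using m(1)[OF A B] m(1)[OF B C] by simp
      show "A \<subseteq> nbhd01 C (hausdorff_dist01 A B + hausdorff_dist01 B C)"
        by (rule nbhd01_trans[OF m(2)[OF A B] m(2)[OF B C]])
      show "C \<subseteq> nbhd01 A (hausdorff_dist01 A B + hausdorff_dist01 B C)"
        using nbhd01_trans[OF m(3)[OF B C] m(3)[OF A B]] by (simp add: add.commute)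
    qed
  qed
qed

lemma mspace_K01_metric [simp]: "mspace K01_metric = K01"
  and mdist_K01_metric [simp]: "mdist K01_metric = hausdorff_dist01"
  by (simp_all add: K01_metric_def Metric_space.mspace_metric Metric_space.mdist_metric Metric_space_K01)

section \<open>Attractors of iterated function systems on \<open>[0,1]\<close>\<close>

text \<open>
  A map \<open>[0,1] \<rightarrow> [0,1]\<close> is represented by any extension to \<open>real\<close>; only its values on \<open>{0..1}\<close>
  are constrained or used.
\<close>

definition contraction01 :: "(real \<Rightarrow> real) \<Rightarrow> bool" where
  "contraction01 f \<longleftrightarrow>
     f \<in> {0..1} \<rightarrow> {0..1} \<and>
     (\<exists>L\<in>{0..<1}. \<forall>x\<in>{0..1}. \<forall>y\<in>{0..1}. \<bar>f x - f y\<bar> \<le> L * \<bar>x - y\<bar>)"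

definition IFS01 :: "(real \<Rightarrow> real) set \<Rightarrow> bool" where
  "IFS01 S \<longleftrightarrow> finite S \<and> S \<noteq> {} \<and> (\<forall>s\<in>S. contraction01 s)"

definition is_attractor01 :: "(real \<Rightarrow> real) set \<Rightarrow> real set \<Rightarrow> bool" where
  "is_attractor01 S A \<longleftrightarrow> A \<in> K01 \<and> A = (\<Union>s\<in>S. s ` A)"

lemma is_attractor01_unique:
  assumes S: "IFS01 S" and AA: "is_attractor01 S A" and BB: "is_attractor01 S B"
  shows "A = B"
proof -
  have A: "A \<in> K01" and Aeq: "A = (\<Union>s\<in>S. s ` A)" and B: "B \<in> K01" and Beq: "B = (\<Union>s\<in>S. s ` B)"
    using AA BB by (auto simp: is_attractor01_def)
  have fin: "finite S" "S \<noteq> {}" using S by (auto simp: IFS01_def)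
  have "\<forall>s\<in>S. \<exists>L\<in>{0..<1}. \<forall>x\<in>{0..1}. \<forall>y\<in>{0..1}. \<bar>s x - s y\<bar> \<le> L * \<bar>x - y\<bar>"
    using S by (auto simp: IFS01_def contraction01_def)
  then obtain l where l: "\<And>s. s \<in> S \<Longrightarrow> l s \<in> {0..<1}"
    "\<And>s x y. \<lbrakk>s \<in> S; x \<in> {0..1}; y \<in> {0..1}\<rbrakk> \<Longrightarrow> \<bar>s x - s y\<bar> \<le> l s * \<bar>x - y\<bar>"
    by metis
  define L where "L = Max (l ` S)"
  have "L \<in> l ` S" unfolding L_def using fin by (intro Max_in) auto
  then have L: "0 \<le> L" "L < 1" using l(1) by auto
  have lL: "l s \<le> L" if "s \<in> S" for s
    unfolding L_def using fin that by auto
  have step: "X \<subseteq> nbhd01 Y (L * h)"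
    if X: "X \<in> K01" and Xeq: "X = (\<Union>s\<in>S. s ` X)" and Y: "Y \<in> K01" and Yeq: "Y = (\<Union>s\<in>S. s ` Y)"
      and h: "X \<subseteq> nbhd01 Y h" for X Y h
  proof
    fix x assume x: "x \<in> X"
    then have "x \<in> (\<Union>s\<in>S. s ` X)" by (subst (asm) Xeq)
    then obtain s x' where s: "s \<in> S" "x' \<in> X" "x = s x'" by blast
    obtain y' where y': "y' \<in> Y" "\<bar>x' - y'\<bar> \<le> h"
      using h s(2) by (force simp: nbhd01_def dist_real_def)
    have "x' \<in> {0..1}" "y' \<in> {0..1}" using X Y s y' by (auto simp: K01_def)
    then have "\<bar>s x' - s y'\<bar> \<le> l s * \<bar>x' - y'\<bar>" using l(2) s(1) by blast
    also have "\<dots> \<le> L * h" using lL[OF s(1)] y'(2) L(1) by (intro mult_mono) auto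
    finally have d: "dist x (s y') \<le> L * h" by (simp add: s(3) dist_real_def)
    have "s y' \<in> (\<Union>s\<in>S. s ` Y)" using s(1) y'(1) by blast
    then have "s y' \<in> Y" using Yeq by simp
    moreover have "x \<in> {0..1}" using X x by (auto simp: K01_def)
    ultimately show "x \<in> nbhd01 Y (L * h)" using d by (auto simp: nbhd01_def)
  qed
  let ?h = "hausdorff_dist01 A B"
  note m = hausdorff_dist01_minimum[OF A B]
  have "?h \<le> L * ?h"
    using step[OF A Aeq B Beq m(2)] step[OF B Beq A Aeq m(3)] m(1) L(1) by (intro m(4)) auto
  then have "(1 - L) * ?h \<le> 0" by (simp add: algebra_simps)
  then have "?h = 0" using m(1) L(2) by (simp add: mult_le_0_iff)
  then show ?thesis using Metric_space.zero[OF Metric_space_K01 A B] by simp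
qed

definition attractors01 :: "real set set" where
  "attractors01 = {A. \<exists>S. IFS01 S \<and> is_attractor01 S A}"

section \<open>Strong porosity\<close>

definition strongly_porous :: "'a metric \<Rightarrow> 'a set \<Rightarrow> bool" where
  "strongly_porous m A \<longleftrightarrow>
     A \<subseteq> mspace m \<and>
     (\<forall>x\<in>mspace m. \<exists>(xs :: nat \<Rightarrow> 'a) (rs :: nat \<Rightarrow> real).
        (\<forall>n. xs n \<in> mspace m) \<and> (\<forall>n. 0 < rs n) \<and>
        limitin (mtopology_of m) xs x sequentially \<and>
        (\<forall>n. 0 < mdist m x (xs n)) \<and>
        (\<lambda>n. rs n / mdist m x (xs n)) \<longlonglongrightarrow> 1 \<and>
        (\<forall>n. mball_of m (xs n) (rs n) \<inter> A = {}))"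

definition sigma_strongly_porous :: "'a metric \<Rightarrow> 'a set \<Rightarrow> bool" where
  "sigma_strongly_porous m A \<longleftrightarrow>
     (\<exists>\<C>. countable \<C> \<and> (\<forall>P\<in>\<C>. strongly_porous m P) \<and> A = \<Union>\<C>)"

end

(* Suppose the attractors are covered by strongly porous sets P_0, P_1, ... Starting from {1/2}, build
   finite sets X_0, X_1, ...: strong porosity of P_n at X_n gives a set Y at an arbitrarily small
   distance e from X_n whose ball of radius 9e/10 misses P_n. Splitting every point of X_n into two
   suitable points at distance at most e yields X_(n+1) within 3e/5 of Y, so a ball of radius 3e/10
   around X_(n+1) still misses P_n. When the scales e decrease fast, the X_n converge to a Cantor set
   that lies in no P_n. This Cantor set is nevertheless an attractor, whatever the positions of the
   points: it is coded by binary words, and prepending a letter to two words moves their first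
   difference one level down, where the scale is much smaller, so it is a contraction. *)

theory Submission
  imports Defs
begin

section \<open>Estimates in the Hausdorff metric\<close>

lemma finite_in_K01:
  assumes "finite X" "X \<noteq> {}" "X \<subseteq> {0<..<1}"
  shows "X \<in> K01"
proof -
  have "X \<subseteq> {0..1}" using assms(3) greaterThanLessThan_subseteq_atLeastAtMost_iff[of 0 1 0 1] by force
  then show ?thesis using assms by (simp add: K01_def finite_imp_compact)
qed

lemma hausdorff_dist01_leI:
  assumes "A \<in> K01" "B \<in> K01" "0 \<le> r"
    and "\<And>a. a \<in> A \<Longrightarrow> \<exists>b\<in>B. \<bar>a - b\<bar> \<le> r"
    and "\<And>b. b \<in> B \<Longrightarrow> \<exists>a\<in>A. \<bar>a - b\<bar> \<le> r"
  shows "hausdorff_dist01 A B \<le> r"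
proof (rule hausdorff_dist01_minimum(4)[OF assms(1,2,3)])
  have sub: "A \<subseteq> {0..1}" "B \<subseteq> {0..1}"
    using assms(1,2) by (auto simp: K01_def)
  show "A \<subseteq> nbhd01 B r"
    using assms(4) sub unfolding nbhd01_def dist_real_def by blast
  show "B \<subseteq> nbhd01 A r"
    using assms(5) sub unfolding nbhd01_def dist_real_def
    by (auto simp: abs_minus_commute)
qed

lemma hausdorff_dist01_near:
  assumes "A \<in> K01" "B \<in> K01" "a \<in> A"
  obtains b where "b \<in> B" "\<bar>a - b\<bar> \<le> hausdorff_dist01 A B"
  using hausdorff_dist01_minimum(2)[OF assms(1,2)] assms(3)
  by (force simp: nbhd01_def dist_real_def)

section \<open>Extension of Lipschitz maps and contractions\<close>

text \<open>McShane's construction: over each point of \<open>D\<close> stands an upward cone of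
  slope \<open>L\<close> with apex on the graph of \<open>f\<close>. The lower envelope of these
  cones inherits the slope, and since \<open>f\<close> is itself \<open>L\<close>-Lipschitz, no cone
  passes below the apex of another.\<close>

lemma lipschitz_on_real_extension:
  fixes f :: "'a::metric_space \<Rightarrow> real"
  assumes lip: "L-lipschitz_on D f"
  obtains g where "L-lipschitz_on UNIV g" "\<And>x. x \<in> D \<Longrightarrow> g x = f x"
proof (cases "D = {}")
  case True
  show ?thesis
    by (rule that[of "\<lambda>_. 0"]) (use True lip lipschitz_on_nonneg in \<open>auto intro!: lipschitz_onI\<close>)
next
  case False
  have L: "0 \<le> L" using lip by (rule lipschitz_on_nonneg)
  define g where "g x = (INF d\<in>D. f d + L * dist x d)" for x
  \<comment> \<open>The downward cone at \<open>c\<close> stays below every upward cone. This bounds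
    the infimum from below, and with \<open>x = c\<close> it gives the harder half of
    \<open>g x = f x\<close> on \<open>D\<close>.\<close>
  have low: "f c - L * dist x c \<le> f d + L * dist x d" if "c \<in> D" "d \<in> D" for x c d
  proof -
    have "f c - f d \<le> L * dist c d"
      using lipschitz_onD[OF lip that] by (simp add: dist_real_def)
    also have "\<dots> \<le> L * (dist x c + dist x d)"
      using L by (intro mult_left_mono dist_triangle3)
    finally show ?thesis by (simp add: algebra_simps)
  qed
  have bdd: "bdd_below ((\<lambda>d. f d + L * dist x d) ` D)" for x
  proof -
    obtain c where "c \<in> D" using False by blast
    then show ?thesis using low by (intro bdd_belowI2)
  qed
  have g_le: "g x \<le> f d + L * dist x d" if "d \<in> D" for x d
    unfolding g_def using bdd that by (rule cINF_lower)
  have g_ge: "c \<le> g x" if "\<And>d. d \<in> D \<Longrightarrow> c \<le> f d + L * dist x d" for c x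
    unfolding g_def using False that by (rule cINF_greatest)
  have half: "g x - L * dist x y \<le> g y" for x y
  proof (rule g_ge)
    fix d assume "d \<in> D"
    then have "g x \<le> f d + L * dist x d" by (rule g_le)
    also have "\<dots> \<le> f d + L * (dist x y + dist y d)"
      using L by (intro add_left_mono mult_left_mono dist_triangle)
    finally show "g x - L * dist x y \<le> f d + L * dist y d" by (simp add: algebra_simps)
  qed
  show ?thesis
  proof (rule that)
    show "L-lipschitz_on UNIV g"
    proof (rule lipschitz_onI)
      fix x y show "dist (g x) (g y) \<le> L * dist x y"
        using half[of x y] half[of y x] by (simp add: dist_real_def dist_commute abs_le_iff)
    qed (rule L)
    fix x assume x: "x \<in> D"
    show "g x = f x"
    proof (rule antisym)
      show "g x \<le> f x" using g_le[OF x, of x] by simp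
      show "f x \<le> g x" using low[OF x, of _ x] by (intro g_ge) simp
    qed
  qed
qed

text \<open>Clamping the extension to \<open>{0..1}\<close> does not increase distances and leaves
  the values on \<open>D\<close> alone, since they already lie there.\<close>

lemma contraction01_extension:
  assumes D: "D \<subseteq> {0..1}" and f: "f \<in> D \<rightarrow> {0..1}"
    and lip: "L-lipschitz_on D f" and "L < 1"
  obtains g where "contraction01 g" "L-lipschitz_on UNIV g" "\<And>x. x \<in> D \<Longrightarrow> g x = f x"
proof -
  obtain h where h: "L-lipschitz_on UNIV h" and heq: "\<And>x. x \<in> D \<Longrightarrow> h x = f x"
    using lipschitz_on_real_extension[OF lip] by blast
  define g where "g x = max 0 (min 1 (h x))" for x
  have L: "0 \<le> L" using h by (rule lipschitz_on_nonneg)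
  have "dist (g x) (g y) \<le> dist (h x) (h y)" for x y
    by (auto simp: g_def dist_real_def)
  then have g: "L-lipschitz_on UNIV g"
    using lipschitz_onD[OF h] L by (meson UNIV_I lipschitz_onI order_trans)
  have "contraction01 g"
    unfolding contraction01_def
  proof
    show "g \<in> {0..1} \<rightarrow> {0..1}" by (auto simp: g_def)
    show "\<exists>L\<in>{0..<1}. \<forall>x\<in>{0..1}. \<forall>y\<in>{0..1}. \<bar>g x - g y\<bar> \<le> L * \<bar>x - y\<bar>"
      using lipschitz_onD[OF g] L \<open>L < 1\<close> by (intro bexI[of _ L]) (auto simp: dist_real_def)
  qed
  moreover have "g x = f x" if "x \<in> D" for x
    using heq[OF that] f that by (auto simp: g_def Pi_iff)
  ultimately show ?thesis using that g by blast
qed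

section \<open>Attractors from coded sets\<close>

text \<open>The maps on words descend to contractions on the coded points, which extend to
  \<open>{0..1}\<close>. By \<open>cover\<close>, the images of the coded set under these maps fill
  it again, and this self-similarity survives the passage to the closure. Where the points lie is
  irrelevant beyond the estimate \<open>contr\<close>.\<close>

lemma closure_coded_set_attractor:
  fixes \<pi> :: "'w \<Rightarrow> real" and c :: "'i \<Rightarrow> 'w \<Rightarrow> 'w"
  assumes I: "finite I" and cover: "(\<Union>i\<in>I. range (c i)) = UNIV"
    and ran: "range \<pi> \<subseteq> {0..1}" and L: "0 \<le> L" "L < 1"
    and contr: "\<And>i v w. i \<in> I \<Longrightarrow> \<bar>\<pi> (c i v) - \<pi> (c i w)\<bar> \<le> L * \<bar>\<pi> v - \<pi> w\<bar>"
  shows "closure (range \<pi>) \<in> attractors01"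
proof -
  let ?D = "range \<pi>"
  have "\<exists>g. contraction01 g \<and> L-lipschitz_on UNIV g \<and> (\<forall>w. g (\<pi> w) = \<pi> (c i w))" if i: "i \<in> I" for i
  proof -
    \<comment> \<open>A point may have several codes and \<open>inv\<close> picks one. The choice
      does not matter: for two codes of the same point the right-hand side of \<open>contr\<close>
      is 0.\<close>
    define f where "f t = \<pi> (c i (inv \<pi> t))" for t
    have inv: "\<pi> (inv \<pi> (\<pi> w)) = \<pi> w" for w by (simp add: f_inv_into_f)
    have f: "f (\<pi> w) = \<pi> (c i w)" for w
      using contr[OF i, of "inv \<pi> (\<pi> w)" w] by (simp add: f_def inv)
    have "L-lipschitz_on ?D f"
      using contr[OF i] L by (intro lipschitz_onI) (auto simp: f dist_real_def)
    moreover have "f \<in> ?D \<rightarrow> {0..1}" using ran by (auto simp: f)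
    ultimately obtain g where "contraction01 g" "L-lipschitz_on UNIV g" "\<And>x. x \<in> ?D \<Longrightarrow> g x = f x"
      using contraction01_extension[OF ran] L by metis
    then show ?thesis using f by auto
  qed
  then obtain g where g: "\<And>i. i \<in> I \<Longrightarrow> contraction01 (g i)"
    and lip: "\<And>i. i \<in> I \<Longrightarrow> L-lipschitz_on UNIV (g i)"
    and geq: "\<And>i w. i \<in> I \<Longrightarrow> g i (\<pi> w) = \<pi> (c i w)"
    by metis
  have bnd: "bounded ?D" using ran bounded_closed_interval bounded_subset by blast
  have "closure ?D \<subseteq> {0..1}" using ran by (simp add: closure_minimal)
  then have K: "closure ?D \<in> K01" using bnd by (simp add: K01_def)
  have im: "g i ` closure ?D = closure (g i ` ?D)" if i: "i \<in> I" for i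
  proof
    have cont: "continuous_on S (g i)" for S
      using lipschitz_on_continuous_on[OF lip[OF i]] continuous_on_subset by blast
    show "g i ` closure ?D \<subseteq> closure (g i ` ?D)"
      by (rule image_closure_subset[OF cont closed_closure closure_subset])
    \<comment> \<open>Continuity alone gives only the first inclusion; the reverse one needs the
      image to be closed, which compactness provides.\<close>
    have "compact (g i ` closure ?D)"
      using bnd by (intro compact_continuous_image cont) simp
    then show "closure (g i ` ?D) \<subseteq> g i ` closure ?D"
      by (intro closure_minimal image_mono closure_subset compact_imp_closed)
  qed
  have "(\<Union>i\<in>I. g i ` ?D) = \<pi> ` (\<Union>i\<in>I. range (c i))"
    using geq by (simp add: image_UN image_image cong: SUP_cong)
  then have D: "(\<Union>i\<in>I. g i ` ?D) = ?D" by (simp add: cover)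
  have "closure (\<Union>i\<in>I. g i ` ?D) = (\<Union>i\<in>I. closure (g i ` ?D))"
    using I by (induction I) auto
  also have "\<dots> = (\<Union>i\<in>I. g i ` closure ?D)" using im by (intro SUP_cong) auto
  finally have "closure ?D = (\<Union>i\<in>I. g i ` closure ?D)" by (simp only: D)
  then have "is_attractor01 (g ` I) (closure ?D)" using K by (simp add: is_attractor01_def)
  moreover have "I \<noteq> {}" using cover by auto
  then have "IFS01 (g ` I)" using I g by (auto simp: IFS01_def)
  ultimately show ?thesis by (auto simp: attractors01_def)
qed

section \<open>Splitting the points of a finite set towards a hole\<close>

text \<open>If \<open>Y\<close> has points within \<open>e\<close> on both sides of
  \<open>t\<close>, then \<open>t - e/2\<close> and \<open>t + e/2\<close> each serve one side, with
  error at most \<open>e/2\<close>. If they all lie on one side, a single point at distance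
  \<open>e/2\<close> serves them all, but a second, distinct one is wanted. Raising the tolerance to
  \<open>3/5 * e\<close> makes room for it at distance \<open>3/5 * e\<close> from \<open>t\<close>,
  hence \<open>e/10\<close> away from the first.\<close>

lemma split_point:
  fixes t e :: real
  assumes "0 < e" "\<exists>s\<in>Y. \<bar>t - s\<bar> \<le> e"
  shows "\<exists>a b. \<bar>a - t\<bar> \<le> e \<and> \<bar>b - t\<bar> \<le> e \<and> e / 10 \<le> \<bar>a - b\<bar> \<and>
    (\<exists>s\<in>Y. \<bar>a - s\<bar> \<le> 3/5 * e) \<and> (\<exists>s\<in>Y. \<bar>b - s\<bar> \<le> 3/5 * e) \<and>
    (\<forall>s\<in>Y. \<bar>t - s\<bar> \<le> e \<longrightarrow> \<bar>a - s\<bar> \<le> 3/5 * e \<or> \<bar>b - s\<bar> \<le> 3/5 * e)"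
proof -
  consider (both) l r where "l \<in> Y" "t - e \<le> l" "l \<le> t" "r \<in> Y" "t \<le> r" "r \<le> t + e"
    | (left) l where "l \<in> Y" "t - e \<le> l" "l \<le> t" "\<And>s. s \<in> Y \<Longrightarrow> \<bar>t - s\<bar> \<le> e \<Longrightarrow> s \<le> t"
    | (right) r where "r \<in> Y" "t \<le> r" "r \<le> t + e" "\<And>s. s \<in> Y \<Longrightarrow> \<bar>t - s\<bar> \<le> e \<Longrightarrow> t \<le> s"
    using assms(2) by (smt (verit))
  then show ?thesis
  proof cases
    case both
    have "\<bar>(t - e/2) - l\<bar> \<le> 3/5 * e" "\<bar>(t + e/2) - r\<bar> \<le> 3/5 * e"
      unfolding abs_le_iff using both \<open>0 < e\<close> by (auto simp: field_simps)
    moreover have "\<bar>(t - e/2) - s\<bar> \<le> 3/5 * e \<or> \<bar>(t + e/2) - s\<bar> \<le> 3/5 * e" if "\<bar>t - s\<bar> \<le> e" for s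
      using that \<open>0 < e\<close> by linarith
    ultimately show ?thesis
      using both \<open>0 < e\<close> by (intro exI[of _ "t - e/2"] exI[of _ "t + e/2"]) auto
  next
    case left
    have "\<bar>(t - e/2) - l\<bar> \<le> 3/5 * e" "\<bar>(t - 3/5 * e) - l\<bar> \<le> 3/5 * e"
      unfolding abs_le_iff using left(1-3) \<open>0 < e\<close> by (auto simp: field_simps)
    moreover have "\<bar>(t - e/2) - s\<bar> \<le> 3/5 * e" if "s \<in> Y" "\<bar>t - s\<bar> \<le> e" for s
      using that left(4)[OF that] \<open>0 < e\<close> by linarith
    ultimately show ?thesis
      using left(1) \<open>0 < e\<close> by (intro exI[of _ "t - e/2"] exI[of _ "t - 3/5 * e"]) auto
  next
    case right
    have "\<bar>(t + e/2) - r\<bar> \<le> 3/5 * e" "\<bar>(t + 3/5 * e) - r\<bar> \<le> 3/5 * e"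
      unfolding abs_le_iff using right(1-3) \<open>0 < e\<close> by (auto simp: field_simps)
    moreover have "\<bar>(t + e/2) - s\<bar> \<le> 3/5 * e" if "s \<in> Y" "\<bar>t - s\<bar> \<le> e" for s
      using that right(4)[OF that] \<open>0 < e\<close> by linarith
    ultimately show ?thesis
      using right(1) \<open>0 < e\<close> by (intro exI[of _ "t + e/2"] exI[of _ "t + 3/5 * e"]) auto
  qed
qed

text \<open>A late enough term of the sequences from strong porosity will do: the ratio tends to 1,
  so it eventually exceeds \<open>q\<close>, while the distance to \<open>x\<close> drops below
  \<open>\<beta>\<close>.\<close>

lemma strongly_porous_hole:
  assumes P: "strongly_porous m P" and x: "x \<in> mspace m" and "0 < \<beta>" "q < 1"
  obtains y where "y \<in> mspace m" "0 < mdist m x y" "mdist m x y < \<beta>"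
    "mball_of m y (q * mdist m x y) \<inter> P = {}"
proof -
  obtain xs :: "nat \<Rightarrow> 'a" and rs :: "nat \<Rightarrow> real"
    where xs_all: "\<forall>n. xs n \<in> mspace m" "\<forall>n. 0 < mdist m x (xs n)" "\<forall>n. mball_of m (xs n) (rs n) \<inter> P = {}"
      and xs_lim: "limitin (mtopology_of m) xs x sequentially"
      and ratio: "(\<lambda>n. rs n / mdist m x (xs n)) \<longlonglongrightarrow> 1"
    using bspec[OF conjunct2[OF P[unfolded strongly_porous_def]] x]
    by (elim exE conjE) (rule that)
  interpret Metric_space "mspace m" "mdist m" by (rule Metric_space_mspace_mdist)
  have "limitin mtopology xs x sequentially" using xs_lim unfolding mtopology_of_def .
  then have "\<forall>\<^sub>F n in sequentially. xs n \<in> mspace m \<and> mdist m (xs n) x < \<beta>"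
    using \<open>0 < \<beta>\<close> unfolding limitin_metric by (elim conjE allE impE)
  then have "\<forall>\<^sub>F n in sequentially. mdist m (xs n) x < \<beta>"
    by (rule eventually_mono) (rule conjunct2)
  moreover have "\<forall>\<^sub>F n in sequentially. q < rs n / mdist m x (xs n)"
    using order_tendstoD(1)[OF ratio \<open>q < 1\<close>] .
  ultimately have "\<forall>\<^sub>F n in sequentially. mdist m (xs n) x < \<beta> \<and> q < rs n / mdist m x (xs n)"
    by eventually_elim simp
  then obtain n where n: "mdist m (xs n) x < \<beta>" "q < rs n / mdist m x (xs n)"
    using eventually_happens'[OF sequentially_bot] by blast
  then have "q * mdist m x (xs n) \<le> rs n"
    using xs_all(2)[rule_format, of n] by (simp add: field_simps)
  then have "mball_of m (xs n) (q * mdist m x (xs n)) \<subseteq> mball_of m (xs n) (rs n)"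
    by (auto simp: mball_of_def)
  then have "mball_of m (xs n) (q * mdist m x (xs n)) \<inter> P = {}"
    using xs_all(3) by blast
  then show ?thesis using that[of "xs n"] xs_all n(1) by (simp add: commute)
qed

lemma finite_set_split_off_porous:
  assumes P: "strongly_porous K01_metric P"
    and X: "finite X" "X \<noteq> {}" "X \<subseteq> {0<..<1}" and "0 < \<beta>"
  obtains e a b where "0 < e" "e \<le> \<beta>" "a ` X \<union> b ` X \<subseteq> {0<..<1}"
    "\<And>t. t \<in> X \<Longrightarrow> \<bar>a t - t\<bar> \<le> e" "\<And>t. t \<in> X \<Longrightarrow> \<bar>b t - t\<bar> \<le> e"
    "\<And>t. t \<in> X \<Longrightarrow> e / 10 \<le> \<bar>a t - b t\<bar>"
    "\<And>Z. Z \<in> P \<Longrightarrow> 3/10 * e \<le> hausdorff_dist01 (a ` X \<union> b ` X) Z"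
proof -
  \<comment> \<open>The distance from \<open>X\<close> to the endpoints of the interval. Taking
    \<open>e\<close> below it keeps the split points in the open interval, so that the step can be
    repeated.\<close>
  define \<rho> where "\<rho> = Min ((\<lambda>t. min t (1 - t)) ` X)"
  have "\<rho> \<le> min t (1 - t)" if "t \<in> X" for t
    unfolding \<rho>_def using X that by (intro Min_le) auto
  moreover have "0 < \<rho>" using X by (auto simp: \<rho>_def)
  ultimately have \<rho>: "0 < \<rho>" "\<And>t. t \<in> X \<Longrightarrow> \<rho> \<le> t \<and> \<rho> \<le> 1 - t"
    by auto
  have XK: "X \<in> K01" using X by (rule finite_in_K01)
  obtain Y where Y: "Y \<in> K01" and pos: "0 < hausdorff_dist01 X Y"
    and lt: "hausdorff_dist01 X Y < min \<beta> \<rho>"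
    and hole: "mball_of K01_metric Y (9/10 * hausdorff_dist01 X Y) \<inter> P = {}"
    using strongly_porous_hole[OF P, of X "min \<beta> \<rho>" "9/10"] XK \<rho>(1) \<open>0 < \<beta>\<close> by auto
  define e where "e = hausdorff_dist01 X Y"
  have near: "\<exists>s\<in>Y. \<bar>t - s\<bar> \<le> e" if "t \<in> X" for t
    using hausdorff_dist01_near[OF XK Y that] unfolding e_def by metis
  have near': "\<exists>t\<in>X. \<bar>t - s\<bar> \<le> e" if "s \<in> Y" for s
    using hausdorff_dist01_near[OF Y XK that] Metric_space.commute[OF Metric_space_K01, of X Y]
    unfolding e_def by (metis abs_minus_commute)
  define split where "split t a b \<longleftrightarrow> \<bar>a - t\<bar> \<le> e \<and> \<bar>b - t\<bar> \<le> e \<and> e / 10 \<le> \<bar>a - b\<bar> \<and>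
      (\<exists>s\<in>Y. \<bar>a - s\<bar> \<le> 3/5 * e) \<and> (\<exists>s\<in>Y. \<bar>b - s\<bar> \<le> 3/5 * e) \<and>
      (\<forall>s\<in>Y. \<bar>t - s\<bar> \<le> e \<longrightarrow> \<bar>a - s\<bar> \<le> 3/5 * e \<or> \<bar>b - s\<bar> \<le> 3/5 * e)" for t a b
  have "\<forall>t\<in>X. \<exists>a b. split t a b"
    unfolding split_def using pos by (intro ballI split_point near) (simp_all add: e_def)
  then obtain a b where "\<And>t. t \<in> X \<Longrightarrow> split t (a t) (b t)"
    by metis
  then have ab: "\<And>t. t \<in> X \<Longrightarrow> \<bar>a t - t\<bar> \<le> e" "\<And>t. t \<in> X \<Longrightarrow> \<bar>b t - t\<bar> \<le> e"
     "\<And>t. t \<in> X \<Longrightarrow> e / 10 \<le> \<bar>a t - b t\<bar>"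
     "\<And>t. t \<in> X \<Longrightarrow> \<exists>s\<in>Y. \<bar>a t - s\<bar> \<le> 3/5 * e" "\<And>t. t \<in> X \<Longrightarrow> \<exists>s\<in>Y. \<bar>b t - s\<bar> \<le> 3/5 * e"
     "\<And>t s. t \<in> X \<Longrightarrow> s \<in> Y \<Longrightarrow> \<bar>t - s\<bar> \<le> e \<Longrightarrow> \<bar>a t - s\<bar> \<le> 3/5 * e \<or> \<bar>b t - s\<bar> \<le> 3/5 * e"
    unfolding split_def by blast+
  let ?Z = "a ` X \<union> b ` X"
  have "a t \<in> {0<..<1} \<and> b t \<in> {0<..<1}" if "t \<in> X" for t
  proof -
    have "e < \<rho>" using lt by (simp add: e_def)
    then show ?thesis
      using ab(1,2)[OF that] \<rho>(2)[OF that] by (simp add: abs_le_iff)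
  qed
  then have Z: "?Z \<subseteq> {0<..<1}" by auto
  have ZK: "?Z \<in> K01" using X Z by (intro finite_in_K01) auto
  \<comment> \<open>Every split point is near \<open>Y\<close> by construction. Conversely, each
    \<open>s\<close> in \<open>Y\<close> is within \<open>e\<close> of some \<open>t\<close> in
    \<open>X\<close>, and one of the two points replacing that \<open>t\<close> is close enough to
    \<open>s\<close>.\<close>
  have ZY: "hausdorff_dist01 ?Z Y \<le> 3/5 * e"
  proof (rule hausdorff_dist01_leI[OF ZK Y])
    show "0 \<le> 3/5 * e" using pos by (simp add: e_def)
    show "\<exists>s\<in>Y. \<bar>z - s\<bar> \<le> 3/5 * e" if "z \<in> ?Z" for z using that ab(4,5) by blast
    show "\<exists>z\<in>?Z. \<bar>z - s\<bar> \<le> 3/5 * e" if s: "s \<in> Y" for s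
      using near'[OF s] ab(6)[OF _ s] by blast
  qed
  show ?thesis
  proof (rule that[of e a b])
    fix Q assume Q: "Q \<in> P"
    then have QK: "Q \<in> K01" using P by (auto simp: strongly_porous_def)
    have "\<not> hausdorff_dist01 Y Q < 9/10 * e"
      using hole Q QK Y unfolding e_def[symmetric] by (auto simp: mball_of_def Metric_space.mball_def[OF Metric_space_K01])
    then show "3/10 * e \<le> hausdorff_dist01 ?Z Q"
      using Metric_space.triangle[OF Metric_space_K01 Y ZK QK] ZY
        Metric_space.commute[OF Metric_space_K01, of Y ?Z] by linarith
  qed (use pos lt Z ab in \<open>auto simp: e_def\<close>)
qed

section \<open>The Cantor set avoiding a sequence of strongly porous sets\<close>

lemma attractor_avoiding_strongly_porous:
  fixes P :: "nat \<Rightarrow> real set set"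
  assumes P: "\<And>n. strongly_porous K01_metric (P n)"
  shows "\<exists>C\<in>attractors01. \<forall>n. C \<notin> P n"
proof -
  \<comment> \<open>A stage is a coding \<open>p\<close> of a finite set, depending on the first \<open>n\<close> letters only, and the scale
    \<open>e\<close> of the last splitting.\<close>
  define good where "good n s \<longleftrightarrow> (case s of (p, e) \<Rightarrow> finite (range p) \<and> range p \<subseteq> {0<..<1} \<and> 0 < e \<and>
      (\<forall>v w. (\<forall>i<n. v i = w i) \<longrightarrow> p v = p w))"
    for n and s :: "((nat \<Rightarrow> bool) \<Rightarrow> real) \<times> real"
  \<comment> \<open>The factor 1000 keeps all later movement below \<open>e' / 100\<close>, small
    against both the separation \<open>e' / 10\<close> and the distance \<open>3/10 * e'\<close>
    from \<open>P n\<close>. The separation concerns words whose first difference is at position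
    \<open>n\<close>.\<close>
  define link where "link n s s' \<longleftrightarrow> (case (s, s') of ((p, e), (p', e')) \<Rightarrow> e' \<le> e / 1000 \<and>
      (\<forall>w. \<bar>p' w - p w\<bar> \<le> e') \<and>
      (\<forall>v w. (\<forall>i<n. v i = w i) \<longrightarrow> v n \<noteq> w n \<longrightarrow> e' / 10 \<le> \<bar>p' v - p' w\<bar>) \<and>
      (\<forall>Z\<in>P n. 3/10 * e' \<le> hausdorff_dist01 (range p') Z))"
    for n and s s' :: "((nat \<Rightarrow> bool) \<Rightarrow> real) \<times> real"
  have "\<exists>s. \<forall>n. good n (s n) \<and> link n (s n) (s (Suc n))"
  proof (rule dependent_nat_choice)
    show "\<exists>s. good 0 s"
      \<comment> \<open>Every word codes the point 1/2. The scale 1 is a default value, as nothing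
        has been split yet.\<close>
      by (rule exI[of _ "(\<lambda>_. 1/2, 1)"]) (simp add: good_def)
    fix s n assume s: "good n s"
    obtain p e where [simp]: "s = (p, e)" by (cases s)
    have p: "finite (range p)" "range p \<subseteq> {0<..<1}" "0 < e" "\<And>v w. (\<And>i. i < n \<Longrightarrow> v i = w i) \<Longrightarrow> p v = p w"
      using s by (auto simp: good_def)
    obtain e' a b where e': "0 < e'" "e' \<le> e / 1000"
      and ran: "a ` range p \<union> b ` range p \<subseteq> {0<..<1}"
      and ab: "\<And>t. t \<in> range p \<Longrightarrow> \<bar>a t - t\<bar> \<le> e'" "\<And>t. t \<in> range p \<Longrightarrow> \<bar>b t - t\<bar> \<le> e'"
        "\<And>t. t \<in> range p \<Longrightarrow> e' / 10 \<le> \<bar>a t - b t\<bar>"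
      and off: "\<And>Z. Z \<in> P n \<Longrightarrow> 3/10 * e' \<le> hausdorff_dist01 (a ` range p \<union> b ` range p) Z"
      using finite_set_split_off_porous[OF P[of n] p(1) _ p(2), of "e / 1000"] p(3) by auto
    define p' where "p' w = (if w n then a (p w) else b (p w))" for w
    \<comment> \<open>The coding \<open>p\<close> does not read letter \<open>n\<close>, so both
      values of this letter are available at every point. Hence \<open>p'\<close> reaches the whole
      split set, the one that \<open>off\<close> speaks of.\<close>
    have upd: "p (w(n := c)) = p w" for w c by (rule p(4)) simp
    have "a (p w) \<in> range p'" "b (p w) \<in> range p'" for w
      using upd[of w True] upd[of w False]
        range_eqI[of _ p' "w(n := True)"] range_eqI[of _ p' "w(n := False)"]
      by (simp_all add: p'_def)
    moreover have "range p' \<subseteq> a ` range p \<union> b ` range p" by (auto simp: p'_def)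
    ultimately have ran': "range p' = a ` range p \<union> b ` range p" by auto
    have "p' v = p' w" if "\<forall>i<Suc n. v i = w i" for v w
      using that p(4)[of v w] by (simp add: p'_def)
    then have "good (Suc n) (p', e')"
      using p(1) ran e'(1) by (simp add: good_def ran')
    moreover have "e' / 10 \<le> \<bar>p' v - p' w\<bar>" if "\<forall>i<n. v i = w i" "v n \<noteq> w n" for v w
    proof -
      have "p v = p w" using that p(4) by blast
      then show ?thesis using that(2) ab(3)[of "p w"] by (auto simp: p'_def abs_minus_commute)
    qed
    moreover have "\<bar>p' w - p w\<bar> \<le> e'" for w
      using ab(1,2)[of "p w"] by (simp add: p'_def)
    ultimately have "good (Suc n) (p', e') \<and> link n s (p', e')"
      using e'(2) off by (simp add: link_def ran')
    then show "\<exists>s'. good (Suc n) s' \<and> link n s s'" by blast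
  qed
  then obtain s where s: "\<And>n. good n (s n)" "\<And>n. link n (s n) (s (Suc n))" by blast
  define p where "p n = fst (s n)" for n
  define e where "e n = snd (s n)" for n
  have seq: "s n = (p n, e n)" for n by (simp add: p_def e_def)
  have fin: "finite (range (p n))" and ran: "range (p n) \<subseteq> {0<..<1}" and pos: "0 < e n"
    and agree: "(\<forall>i<n. v i = w i) \<Longrightarrow> p n v = p n w" for n v w
    using s(1)[of n] by (auto simp: good_def seq)
  have decr: "e (Suc n) \<le> e n / 1000" and move: "\<bar>p (Suc n) w - p n w\<bar> \<le> e (Suc n)"
    and sep: "(\<forall>i<n. v i = w i) \<Longrightarrow> v n \<noteq> w n \<Longrightarrow> e (Suc n) / 10 \<le> \<bar>p (Suc n) v - p (Suc n) w\<bar>"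
    and off: "Z \<in> P n \<Longrightarrow> 3/10 * e (Suc n) \<le> hausdorff_dist01 (range (p (Suc n))) Z" for n v w Z
    using s(2)[of n] by (auto simp: link_def seq)
  \<comment> \<open>The subtracted term makes the induction close: \<open>e (Suc m)\<close> is at
    most a hundredth of \<open>e m - e (Suc m)\<close>, so the movements telescope.\<close>
  have tail: "\<bar>p (n + k) w - p n w\<bar> \<le> e n / 100 - e (n + k) / 100" for n k w
  proof (induction k)
    case (Suc k)
    then show ?case using move[of "n + k" w] decr[of "n + k"] pos[of "n + k"] by simp
  qed simp
  have close: "\<bar>p m w - p n w\<bar> \<le> e n / 100" if "n \<le> m" for m n w
    using tail[of n "m - n" w] that pos[of m] by simp
  have e_small: "e n \<le> e 0 * (1/2) ^ n" for n
  proof (induction n)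
    case (Suc n)
    then show ?case using decr[of n] pos[of n] by simp
  qed simp
  have "(\<lambda>n. e 0 * (1/2) ^ n) \<longlonglongrightarrow> e 0 * 0"
    by (intro tendsto_mult tendsto_const LIMSEQ_power_zero) simp
  then have e_lim: "e \<longlonglongrightarrow> 0"
    using tendsto_sandwich[of "\<lambda>_. 0" e sequentially "\<lambda>n. e 0 * (1/2) ^ n" 0]
      pos[THEN less_imp_le] e_small by simp
  have "Cauchy (\<lambda>n. p n w)" for w
  proof (rule CauchyI')
    fix r :: real assume "0 < r"
    then have "\<forall>\<^sub>F n in sequentially. e n < r" using order_tendstoD(2)[OF e_lim] by blast
    then obtain M where M: "e M < r" using eventually_happens'[OF sequentially_bot] by blast
    show "\<exists>M. \<forall>m\<ge>M. \<forall>n>m. dist (p m w) (p n w) < r"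
    proof (intro exI allI impI)
      fix m n assume "M \<le> m" "m < n"
      then show "dist (p m w) (p n w) < r"
        using close[of M m w] close[of M n w] M pos[of M] unfolding dist_real_def by linarith
    qed
  qed
  then have conv: "convergent (\<lambda>n. p n w)" for w using real_Cauchy_convergent by blast
  define \<pi> where "\<pi> w = lim (\<lambda>n. p n w)" for w
  have lim: "(\<lambda>n. p n w) \<longlonglongrightarrow> \<pi> w" for w
    unfolding \<pi>_def using conv by (rule convergent_LIMSEQ_iff[THEN iffD1])
  have near: "\<bar>\<pi> w - p n w\<bar> \<le> e n / 100" for n w
  proof (rule LIMSEQ_le_const2)
    show "(\<lambda>m. \<bar>p m w - p n w\<bar>) \<longlonglongrightarrow> \<bar>\<pi> w - p n w\<bar>" by (intro tendsto_intros lim)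
    show "\<exists>N. \<forall>m\<ge>N. \<bar>p m w - p n w\<bar> \<le> e n / 100" using close by blast
  qed
  have "\<pi> w \<in> {0..1}" for w
  proof -
    have "0 \<le> p n w \<and> p n w \<le> 1" for n using ran[of n] by (auto simp: image_subset_iff intro: less_imp_le)
    then show ?thesis using LIMSEQ_le_const[OF lim] LIMSEQ_le_const2[OF lim] by auto
  qed
  then have \<pi>ran: "range \<pi> \<subseteq> {0..1}" by auto
  define C where "C = closure (range \<pi>)"
  have "C \<in> attractors01"
    unfolding C_def
  \<comment> \<open>Two maps suffice, one for each letter that can be prepended.\<close>
  proof (rule closure_coded_set_attractor[where I = UNIV and c = "\<lambda>c w. case_nat c w" and L = "1/2"])
    have "w = case_nat (w 0) (\<lambda>n. w (Suc n))" for w :: "nat \<Rightarrow> bool"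
      by (auto simp: fun_eq_iff split: nat.split)
    then show "(\<Union>c\<in>UNIV. range (case_nat c)) = (UNIV :: (nat \<Rightarrow> bool) set)" by blast
    fix c and v w :: "nat \<Rightarrow> bool"
    show "\<bar>\<pi> (case_nat c v) - \<pi> (case_nat c w)\<bar> \<le> 1/2 * \<bar>\<pi> v - \<pi> w\<bar>"
    proof (cases "v = w")
      case False
      then have ex: "\<exists>n. v n \<noteq> w n" by auto
      define n where "n = (LEAST n. v n \<noteq> w n)"
      have n: "v n \<noteq> w n" "\<forall>i<n. v i = w i"
        unfolding n_def using LeastI_ex[OF ex] not_less_Least by blast+
      \<comment> \<open>Prepending shifts the first difference from \<open>n\<close> to
        \<open>Suc n\<close>, which \<open>p (Suc n)\<close> does not read, although it already
        separates \<open>v\<close> from \<open>w\<close>. So the new limits are at most two errors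
        \<open>e (Suc n) / 100\<close> apart, while the old ones keep \<open>e (Suc n) / 10\<close>
        minus two such errors.\<close>
      have "\<forall>i<Suc n. case_nat c v i = case_nat c w i" using n(2) by (auto split: nat.split)
      then have "p (Suc n) (case_nat c v) = p (Suc n) (case_nat c w)" by (rule agree)
      then have "\<bar>\<pi> (case_nat c v) - \<pi> (case_nat c w)\<bar> \<le> e (Suc n) / 50"
        using near[of "case_nat c v" "Suc n"] near[of "case_nat c w" "Suc n"] by linarith
      also have "\<dots> \<le> 1/2 * (e (Suc n) / 10 - e (Suc n) / 50)"
        using pos[of "Suc n"] by simp
      also have "e (Suc n) / 10 - e (Suc n) / 50 \<le> \<bar>\<pi> v - \<pi> w\<bar>"
        using near[of v "Suc n"] near[of w "Suc n"] sep[OF n(2,1)] by linarith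
      finally show ?thesis by simp
    qed simp
  qed (use \<pi>ran in auto)
  moreover have "C \<notin> P n" for n
  proof
    assume "C \<in> P n"
    then have far: "3/10 * e (Suc n) \<le> hausdorff_dist01 (range (p (Suc n))) C" by (rule off)
    have CK: "C \<in> K01" using \<open>C \<in> attractors01\<close> by (auto simp: attractors01_def is_attractor01_def)
    have pK: "range (p (Suc n)) \<in> K01"
      using fin ran by (intro finite_in_K01) auto
    \<comment> \<open>One error \<open>e (Suc n) / 100\<close> comes from the limit, a second one
      from approximating points of the closure by coded points. The sum is still far below
      \<open>3/10 * e (Suc n)\<close>.\<close>
    have "hausdorff_dist01 (range (p (Suc n))) C \<le> e (Suc n) / 50"
    proof (rule hausdorff_dist01_leI[OF pK CK])
      show "0 \<le> e (Suc n) / 50" using pos[of "Suc n"] by simp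
      show "\<exists>c\<in>C. \<bar>a - c\<bar> \<le> e (Suc n) / 50" if a: "a \<in> range (p (Suc n))" for a
      proof -
        obtain w where "a = p (Suc n) w" using a by blast
        moreover have "\<pi> w \<in> C" using closure_subset[of "range \<pi>"] by (auto simp: C_def)
        ultimately show ?thesis
          using near[of w "Suc n"] pos[of "Suc n"]
          by (intro bexI[of _ "\<pi> w"]) (simp_all add: abs_minus_commute)
      qed
      show "\<exists>a\<in>range (p (Suc n)). \<bar>a - c\<bar> \<le> e (Suc n) / 50" if c: "c \<in> C" for c
      proof -
        obtain w where "dist (\<pi> w) c < e (Suc n) / 100"
          using c pos[of "Suc n"] unfolding C_def closure_approachable
          by (metis divide_pos_pos rangeE zero_less_numeral)
        then show ?thesis
          using near[of w "Suc n"] unfolding dist_real_def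
          by (intro bexI[of _ "p (Suc n) w"] rangeI) linarith
      qed
    qed
    then show False using far pos[of "Suc n"] by simp
  qed
  ultimately show ?thesis by blast
qed

section \<open>From countable families to sequences of strongly porous sets\<close>

theorem theorem4p1:
  shows "\<not> sigma_strongly_porous K01_metric attractors01"
proof
  assume "sigma_strongly_porous K01_metric attractors01"
  then obtain \<C> where \<C>: "countable \<C>" "\<And>P. P \<in> \<C> \<Longrightarrow> strongly_porous K01_metric P"
    "attractors01 = \<Union>\<C>"
    by (auto simp: sigma_strongly_porous_def)
  \<comment> \<open>Some attractor must be exhibited to exclude the empty family, since
    \<open>from_nat_into\<close> enumerates only nonempty ones.\<close>
  have "contraction01 (\<lambda>_. 0)" by (auto simp: contraction01_def intro: bexI[of _ 0])
  then have "{0} \<in> attractors01"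
    by (auto simp: attractors01_def IFS01_def is_attractor01_def K01_def intro!: exI[of _ "{\<lambda>_. 0}"])
  then have ne: "\<C> \<noteq> {}" using \<C>(3) by auto
  obtain C where "C \<in> attractors01" "\<And>n. C \<notin> from_nat_into \<C> n"
    using attractor_avoiding_strongly_porous[of "from_nat_into \<C>"] \<C>(2) from_nat_into[OF ne] by blast
  then show False using \<C>(1,3) ne by (metis UnionE from_nat_into_to_nat_on)
qed

end
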